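(* Let $S=(S,+,\circ)$ be a weak brace, let $r$ be the solution associated to $S$, and let $r^{op}$ be the solution associated to the opposite weak brace $S^{op}$ of $S$. Then $$r\,r^{op}\,r=r,\qquad r^{op}\,r\,r^{op}=r^{op},\qquad\text{and}\qquad r\,r^{op}=r^{op}\,r,$$ that is, $r$ is a completely regular element of the full transformation semigroup on $S\times S$. Moreover, $r\,r^{op}$ is a set-theoretic solution of the Yang-Baxter equation on $S$. In particular, if $S$ is a skew brace, then $r$ is bijective with $r^{-1}=r^{op}$.
   Context: A semigroup is inverse if each element $a$ has a unique inverse, i.e. a unique $x$ with $axa=a$ and $xax=x$. A weak (left) brace is a non-empty set $S$ with two binary operations $+$ and $\circ$ such that $(S,+)$ and $(S,\circ)$ are both inverse semigroups (not necessarily commutative) and, for all $a,b,c\in S$, $a\circ(b+c)=a\circ b-a+a\circ c$ and $a\circ a^-=-a+a$, where $-a$ is the inverse of $a$ in $(S,+)$, $a^-$ is the inverse of $a$ in $(S,\circ)$, and $\circ$ has higher precedence than $+$. A skew (left) brace is a triple $(S,+,\circ)$ with $(S,+)$ and $(S,\circ)$ groups satisfying $a\circ(b+c)=a\circ b-a+a\circ c$ for all $a,b,c$; it is a weak brace. The map associated to a weak brace $S$ is $r:S\times S\to S\times S$, $r(a,b)=(a\circ(a^-+b),\ (a^-+b)^-\circ b)$; it is known to be a set-theoretic solution of the Yang-Baxter equation, i.e. $(r\times \mathrm{id}_S)(\mathrm{id}_S\times r)(r\times \mathrm{id}_S)=(\mathrm{id}_S\times r)(r\times \mathrm{id}_S)(\mathrm{id}_S\times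 r)$. The opposite weak brace is $S^{op}=(S,+^{op},\circ)$ with $a+^{op}b:=b+a$; it is a weak brace, and so $r^{op}(a,b)=(a\circ(b+a^-),\ (b+a^-)^-\circ b)$. Juxtaposition of maps denotes composition. An element $x$ of a semigroup is called completely regular if it has an inverse $y$ ($xyx=x$, $yxy=y$) with $xy=yx$. *)

theory Defs
  imports Main
begin

definition inverse_of :: "('a \<Rightarrow> 'a \<Rightarrow> 'a) \<Rightarrow> 'a \<Rightarrow> 'a \<Rightarrow> bool" where
  "inverse_of m a x \<longleftrightarrow> m (m a x) a = a \<and> m (m x a) x = x"

locale inverse_semigroup = semigroup m for m :: "'a \<Rightarrow> 'a \<Rightarrow> 'a" +
  assumes ex1_inverse: "\<exists>!x. inverse_of m a x"

definition the_inverse :: "('a \<Rightarrow> 'a \<Rightarrow> 'a) \<Rightarrow> 'a \<Rightarrow> 'a" where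
  "the_inverse m a = (THE x. inverse_of m a x)"

text \<open>The underlying set of a brace is the whole type \<open>'a\<close>, which is never empty.\<close>

locale weak_brace =
  fixes add :: "'a \<Rightarrow> 'a \<Rightarrow> 'a"  (infixl "\<oplus>" 65)
    and circ :: "'a \<Rightarrow> 'a \<Rightarrow> 'a"  (infixl "\<odot>" 70)
  assumes add_inverse_semigroup: "inverse_semigroup (\<oplus>)"
    and circ_inverse_semigroup: "inverse_semigroup (\<odot>)"
    and circ_add: "a \<odot> (b \<oplus> c) = a \<odot> b \<oplus> the_inverse (\<oplus>) a \<oplus> a \<odot> c"
    and circ_inverse: "a \<odot> the_inverse (\<odot>) a = the_inverse (\<oplus>) a \<oplus> a"

locale skew_brace =
  fixes add :: "'a \<Rightarrow> 'a \<Rightarrow> 'a"  (infixl "\<oplus>" 65)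
    and circ :: "'a \<Rightarrow> 'a \<Rightarrow> 'a"  (infixl "\<odot>" 70)
  assumes groups: "\<exists>z neg e inv'. group (\<oplus>) z neg \<and> group (\<odot>) e inv' \<and>
    (\<forall>a b c. a \<odot> (b \<oplus> c) = a \<odot> b \<oplus> neg a \<oplus> a \<odot> c)"

definition brace_map :: "('a \<Rightarrow> 'a \<Rightarrow> 'a) \<Rightarrow> ('a \<Rightarrow> 'a \<Rightarrow> 'a) \<Rightarrow> 'a \<times> 'a \<Rightarrow> 'a \<times> 'a" where
  "brace_map add circ = (\<lambda>(a, b).
     (circ a (add (the_inverse circ a) b),
      circ (the_inverse circ (add (the_inverse circ a) b)) b))"

definition opposite :: "('a \<Rightarrow> 'a \<Rightarrow> 'a) \<Rightarrow> 'a \<Rightarrow> 'a \<Rightarrow> 'a" where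
  "opposite m a b = m b a"

text \<open>Triples are nested to the right, so \<open>id \<times> r\<close> is \<open>map_prod id r\<close>, whereas
  \<open>r \<times> id\<close> has to be written out.\<close>

definition prod_id :: "('a \<times> 'a \<Rightarrow> 'a \<times> 'a) \<Rightarrow> 'a \<times> 'a \<times> 'a \<Rightarrow> 'a \<times> 'a \<times> 'a" where
  "prod_id r = (\<lambda>(x, y, z). case r (x, y) of (u, v) \<Rightarrow> (u, v, z))"

definition yang_baxter :: "('a \<times> 'a \<Rightarrow> 'a \<times> 'a) \<Rightarrow> bool" where
  "yang_baxter r \<longleftrightarrow>
     prod_id r \<circ> map_prod id r \<circ> prod_id r = map_prod id r \<circ> prod_id r \<circ> map_prod id r"

definition completely_regular :: "('a \<Rightarrow> 'a \<Rightarrow> 'a) \<Rightarrow> 'a \<Rightarrow> bool" where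
  "completely_regular m x \<longleftrightarrow> (\<exists>y. inverse_of m x y \<and> m x y = m y x)"

lemma brace_map_opposite:
  "brace_map (opposite add) circ (a, b) =
     (circ a (add b (the_inverse circ a)),
      circ (the_inverse circ (add b (the_inverse circ a))) b)"
  by (simp add: brace_map_def opposite_def)

lemma group_inverse_of_iff:
  assumes "group m e i"
  shows "inverse_of m a x \<longleftrightarrow> x = i a"
proof -
  interpret group m e i by fact
  show ?thesis
    unfolding inverse_of_def
    by (metis assoc group_left_neutral left_inverse right_inverse right_neutral)
qed

lemma group_the_inverse:
  assumes "group m e i"
  shows "the_inverse m = i"
  by (simp add: fun_eq_iff the_inverse_def group_inverse_of_iff[OF assms])

lemma group_inverse_semigroup:
  assumes "group m e i"
  shows "inverse_semigroup m"
proof -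
  interpret group m e i by fact
  show ?thesis
    by unfold_locales (simp add: group_inverse_of_iff[OF assms])
qed

lemma skew_brace_imp_weak_brace:
  assumes "skew_brace add circ"
  shows "weak_brace add circ"
proof -
  obtain z neg e inv' where A: "group add z neg" and C: "group circ e inv'"
    and D: "\<And>a b c. circ a (add b c) = add (add (circ a b) (neg a)) (circ a c)"
    using assms unfolding skew_brace_def by blast
  interpret A: group add z neg by (fact A)
  interpret C: group circ e inv' by (fact C)
  have "z = neg e"
    using D[of e z z] by simp
  hence "e = z"
    by (metis A.right_inverse A.right_neutral)
  thus ?thesis
    by (intro weak_brace.intro)
      (simp_all add: group_inverse_semigroup[OF A] group_inverse_semigroup[OF C]
        group_the_inverse[OF A] group_the_inverse[OF C] D)
qed

end

theory Submission imports Defs begin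

text \<open>
  Write \<open>p = a \<circ> b\<close> and \<open>0\<^sub>x = x - x = x \<circ> x\<^sup>-\<close>. The key point is that both solutions preserve the
  product \<open>p\<close> and that a pair in their image is determined by \<open>p\<close> and its first component \<open>u\<close>, the
  second one being \<open>u\<^sup>- \<circ> p\<close> (\<open>brace_map_eq\<close>, \<open>brace_map_product\<close>). On first components \<open>r\<close> is
  \<open>a \<mapsto> -a + p\<close> and \<open>r\<^sup>o\<^sup>p\<close> is \<open>a \<mapsto> p - a\<close>. Both composites therefore send \<open>a\<close> to \<open>a + 0\<^sub>p = 0\<^sub>p + a\<close>,
  and since \<open>0\<^sub>p\<close> is absorbed by \<open>-a + p\<close>, applying \<open>r r\<^sup>o\<^sup>p\<close> after \<open>r\<close> changes nothing. The other half
  of regularity is the same statement for the opposite weak brace.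

  These computations need the idempotents to be under control. The additive semigroup is Clifford,
  so all \<open>0\<^sub>x\<close> are central for \<open>+\<close> (\<open>minus_add_commute\<close>, \<open>local_zero_central\<close>); this is also what
  makes the opposite structure a weak brace. Moreover \<open>+\<close> and \<open>\<circ>\<close> have the same idempotents \<open>e\<close>, and
  \<open>e \<circ> a = e + a\<close> (\<open>idem_circ\<close>).

  Translating \<open>0\<^sub>p + a\<close> by means of \<open>idem_circ\<close> into \<open>\<circ>\<close> alone gives
  \<open>r r\<^sup>o\<^sup>p (a, b) = (a \<circ> b \<circ> b\<^sup>-, a\<^sup>- \<circ> a \<circ> b)\<close>. This map satisfies the Yang-Baxter equation in every inverse
  semigroup (\<open>yang_baxter_idem_exchange\<close>), because idempotents commute; in a group it is the
  identity, whence the claim on skew braces.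
\<close>

section \<open>Inverse semigroups\<close>

context inverse_semigroup
begin

notation m (infixl "\<cdot>" 70)

abbreviation inv_elem :: "'a \<Rightarrow> 'a"  ("_\<^sup>-" [1000] 999) where
  "a\<^sup>- \<equiv> the_inverse m a"

lemma inverse_of_the_inverse: "inverse_of m a (a\<^sup>-)"
  unfolding the_inverse_def by (rule theI'[OF ex1_inverse])

lemma inverse_eqI: "inverse_of m a x \<Longrightarrow> a\<^sup>- = x"
  using ex1_inverse[of a] inverse_of_the_inverse by blast

lemma regular: "a \<cdot> a\<^sup>- \<cdot> a = a" "a\<^sup>- \<cdot> a \<cdot> a\<^sup>- = a\<^sup>-"
  using inverse_of_the_inverse[of a] by (simp_all add: inverse_of_def)

lemma regular_assoc: "a \<cdot> (a\<^sup>- \<cdot> a) = a" "a\<^sup>- \<cdot> (a \<cdot> a\<^sup>-) = a\<^sup>-"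
    "a \<cdot> (a\<^sup>- \<cdot> (a \<cdot> b)) = a \<cdot> b" "a\<^sup>- \<cdot> (a \<cdot> (a\<^sup>- \<cdot> b)) = a\<^sup>- \<cdot> b"
  using regular[of a] by (metis assoc)+

lemma inverse_inverse: "(a\<^sup>-)\<^sup>- = a"
  by (rule inverse_eqI) (simp add: inverse_of_def regular)

lemma inverse_idem: "e \<cdot> e = e \<Longrightarrow> e\<^sup>- = e"
  by (rule inverse_eqI) (simp add: inverse_of_def)

lemma idem_left: "(a \<cdot> a\<^sup>-) \<cdot> (a \<cdot> a\<^sup>-) = a \<cdot> a\<^sup>-"
  and idem_right: "(a\<^sup>- \<cdot> a) \<cdot> (a\<^sup>- \<cdot> a) = a\<^sup>- \<cdot> a"
  by (simp_all add: assoc regular_assoc)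

text \<open>
  If \<open>x\<close> is the inverse of \<open>ef\<close>, then so is \<open>fxe\<close>. By uniqueness \<open>x = fxe\<close>, which makes \<open>x\<close> idempotent;
  an idempotent is its own inverse, so \<open>ef = x\<close>.
\<close>

lemma idem_mult:
  assumes e: "e \<cdot> e = e" and f: "f \<cdot> f = f"
  shows "(e \<cdot> f) \<cdot> (e \<cdot> f) = e \<cdot> f"
proof -
  let ?x = "(e \<cdot> f)\<^sup>-"
  have e': "e \<cdot> (e \<cdot> y) = e \<cdot> y" and f': "f \<cdot> (f \<cdot> y) = f \<cdot> y" for y
    by (simp_all add: e f flip: assoc)
  have r1: "e \<cdot> (f \<cdot> (?x \<cdot> (e \<cdot> f))) = e \<cdot> f"
    using regular(1)[of "e \<cdot> f"] by (simp add: assoc)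
  have r2: "?x \<cdot> (e \<cdot> (f \<cdot> ?x)) = ?x"
    using regular(2)[of "e \<cdot> f"] by (simp add: assoc)
  have r2': "?x \<cdot> (e \<cdot> (f \<cdot> (?x \<cdot> y))) = ?x \<cdot> y" for y
    using r2 by (metis assoc)
  have x: "?x = f \<cdot> ?x \<cdot> e"
    by (rule inverse_eqI) (simp add: inverse_of_def assoc e' f' r1 r2')
  have "?x \<cdot> ?x = (f \<cdot> ?x \<cdot> e) \<cdot> (f \<cdot> ?x \<cdot> e)"
    using x by metis
  also have "\<dots> = f \<cdot> ?x \<cdot> e"
    by (simp add: assoc r2')
  finally have xx: "?x \<cdot> ?x = ?x"
    using x by metis
  hence "e \<cdot> f = ?x"
    using inverse_idem inverse_inverse by metis
  thus ?thesis
    using xx by metis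
qed

text \<open>
  Since products of idempotents are idempotent, both \<open>fe\<close> and \<open>ef\<close> itself are inverses of \<open>ef\<close>.
\<close>

lemma idem_commute:
  assumes e: "e \<cdot> e = e" and f: "f \<cdot> f = f"
  shows "e \<cdot> f = f \<cdot> e"
proof -
  have e': "e \<cdot> (e \<cdot> y) = e \<cdot> y" and f': "f \<cdot> (f \<cdot> y) = f \<cdot> y" for y
    by (simp_all add: e f flip: assoc)
  have "inverse_of m (e \<cdot> f) (f \<cdot> e)"
    using idem_mult[OF e f] idem_mult[OF f e]
    by (simp add: inverse_of_def assoc e' f')
  moreover have "(e \<cdot> f)\<^sup>- = e \<cdot> f"
    by (rule inverse_idem[OF idem_mult[OF e f]])
  ultimately show ?thesis
    using inverse_eqI by metis
qed

lemma inverse_mult: "(a \<cdot> b)\<^sup>- = b\<^sup>- \<cdot> a\<^sup>-"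
proof (rule inverse_eqI)
  have c: "b \<cdot> (b\<^sup>- \<cdot> (a\<^sup>- \<cdot> (a \<cdot> y))) = a\<^sup>- \<cdot> (a \<cdot> (b \<cdot> (b\<^sup>- \<cdot> y)))" for y
    using idem_commute[OF idem_left[of b] idem_right[of a]] by (metis assoc)
  have "a \<cdot> (b \<cdot> (b\<^sup>- \<cdot> (a\<^sup>- \<cdot> (a \<cdot> b)))) = a \<cdot> b"
    by (simp add: c regular_assoc)
  moreover have "b\<^sup>- \<cdot> (a\<^sup>- \<cdot> (a \<cdot> (b \<cdot> (b\<^sup>- \<cdot> a\<^sup>-)))) = b\<^sup>- \<cdot> a\<^sup>-"
    by (simp add: regular_assoc flip: c)
  ultimately show "inverse_of m (a \<cdot> b) (b\<^sup>- \<cdot> a\<^sup>-)"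
    by (simp add: inverse_of_def assoc)
qed

text \<open>
  An inverse semigroup in which every element commutes with its inverse is a Clifford semigroup.
  Applying the hypothesis to \<open>ea\<close> shows that conjugating \<open>e\<close> by \<open>a\<close> only multiplies it by \<open>aa\<^sup>-\<close>.
\<close>

lemma idem_central:
  assumes normal: "\<And>a. a \<cdot> a\<^sup>- = a\<^sup>- \<cdot> a" and e: "e \<cdot> e = e"
  shows "e \<cdot> a = a \<cdot> e"
proof -
  have comm: "e \<cdot> (a \<cdot> a\<^sup>-) = a \<cdot> a\<^sup>- \<cdot> e"
    by (rule idem_commute[OF e idem_left])
  have "e \<cdot> a \<cdot> (a\<^sup>- \<cdot> e) = a\<^sup>- \<cdot> e \<cdot> (e \<cdot> a)"
    using normal[of "e \<cdot> a"] by (simp add: inverse_mult inverse_idem[OF e])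
  hence conj: "a\<^sup>- \<cdot> (e \<cdot> a) = a \<cdot> a\<^sup>- \<cdot> e"
    using comm by (metis assoc e)
  have "e \<cdot> a = e \<cdot> (a \<cdot> a\<^sup>-) \<cdot> a"
    by (simp add: assoc regular_assoc)
  also have "\<dots> = a \<cdot> (a\<^sup>- \<cdot> (e \<cdot> a))"
    by (simp add: comm) (simp add: assoc)
  also have "\<dots> = a \<cdot> (a\<^sup>- \<cdot> a) \<cdot> e"
    by (simp add: conj) (simp add: normal assoc)
  finally show ?thesis
    by (simp add: regular_assoc)
qed

text \<open>
  Each step of the map only multiplies a component by the left unit of its right neighbour or by the
  right unit of its left neighbour. Both sides of the equation yield the triple
  \<open>(a L(b L(c)), R(a) b L(c), R(R(a) b) c)\<close>, where \<open>L\<close> and \<open>R\<close> denote these units.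
\<close>

lemma yang_baxter_idem_exchange:
  "yang_baxter (\<lambda>(a, b). (a \<cdot> (b \<cdot> b\<^sup>-), a\<^sup>- \<cdot> a \<cdot> b))"
proof -
  define L where "L x = x \<cdot> x\<^sup>-" for x
  define R where "R x = x\<^sup>- \<cdot> x" for x
  have L_idem: "L x \<cdot> L x = L x" and R_idem: "R x \<cdot> R x = R x" for x
    by (simp_all add: L_def R_def idem_left idem_right)
  have L_comm: "L x \<cdot> R y = R y \<cdot> L x" for x y
    by (simp add: L_idem R_idem idem_commute)
  have L_comm': "L x \<cdot> (R y \<cdot> z) = R y \<cdot> (L x \<cdot> z)" for x y z
    using L_comm by (metis assoc)
  have R_idem': "R x \<cdot> (R x \<cdot> z) = R x \<cdot> z" for x z
    using R_idem by (metis assoc)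
  have absorb: "x \<cdot> R x = x" "L x \<cdot> x = x" "x \<cdot> (R x \<cdot> z) = x \<cdot> z"
      "L x \<cdot> (x \<cdot> z) = x \<cdot> z" for x z
    by (simp_all add: L_def R_def assoc regular_assoc)
  have L_mult: "L (e \<cdot> x) = e \<cdot> L x" and R_mult: "R (x \<cdot> e) = R x \<cdot> e"
    if e: "e \<cdot> e = e" for e x
  proof -
    have "L (e \<cdot> x) = e \<cdot> (L x \<cdot> e)"
      by (simp add: L_def inverse_mult inverse_idem[OF e] assoc)
    also have "\<dots> = e \<cdot> L x"
      using idem_commute[OF L_idem e] by (metis assoc e)
    finally show "L (e \<cdot> x) = e \<cdot> L x" .
    have "R (x \<cdot> e) = e \<cdot> R x \<cdot> e"
      by (simp add: R_def inverse_mult inverse_idem[OF e] assoc)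
    also have "\<dots> = R x \<cdot> e"
      using idem_commute[OF R_idem e] by (metis assoc e)
    finally show "R (x \<cdot> e) = R x \<cdot> e" .
  qed
  have L_absorb: "L x \<cdot> L (x \<cdot> y) = L (x \<cdot> y)"
    and R_absorb: "R (x \<cdot> y) \<cdot> (R y \<cdot> z) = R (x \<cdot> y) \<cdot> z" for x y z
    by (simp_all add: L_def R_def inverse_mult assoc regular_assoc)
  note rules = assoc absorb L_mult[OF L_idem] L_mult[OF R_idem] R_mult[OF L_idem] L_comm L_comm'
    L_absorb R_absorb R_idem'
  have "yang_baxter (\<lambda>(a, b). (a \<cdot> L b, R a \<cdot> b))"
    unfolding yang_baxter_def fun_eq_iff
  proof (clarsimp simp: prod_id_def, intro conjI)
    fix a b c
    show "a \<cdot> L b \<cdot> L (R a \<cdot> b \<cdot> L c) = a \<cdot> L (b \<cdot> L c)"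
      by (simp add: rules)
    show "R (a \<cdot> L b) \<cdot> (R a \<cdot> b \<cdot> L c) = R a \<cdot> (b \<cdot> L c) \<cdot> L (R b \<cdot> c)"
      by (simp add: rules L_idem)
    have "R (R a \<cdot> (b \<cdot> L c)) \<cdot> (R b \<cdot> c) = R (R a \<cdot> b) \<cdot> (R b \<cdot> (L c \<cdot> c))"
      using R_mult[OF L_idem, of "R a \<cdot> b" c] by (simp add: assoc L_comm')
    thus "R (R a \<cdot> b) \<cdot> c = R (R a \<cdot> (b \<cdot> L c)) \<cdot> (R b \<cdot> c)"
      by (simp add: absorb R_absorb)
  qed
  thus ?thesis
    by (simp add: L_def R_def)
qed

end

lemma opposite_opposite: "opposite (opposite m) = m"
  by (simp add: opposite_def fun_eq_iff)

lemma the_inverse_opposite: "the_inverse (opposite m) = the_inverse m"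
  if "inverse_semigroup m" for m :: "'a \<Rightarrow> 'a \<Rightarrow> 'a"
proof -
  interpret inverse_semigroup m by fact
  show ?thesis
    by (simp add: the_inverse_def inverse_of_def opposite_def assoc fun_eq_iff)
qed

section \<open>The additive semigroup of a weak brace\<close>

context weak_brace
begin

sublocale A: inverse_semigroup "(\<oplus>)" by (rule add_inverse_semigroup)
sublocale C: inverse_semigroup "(\<odot>)" by (rule circ_inverse_semigroup)

abbreviation neg :: "'a \<Rightarrow> 'a"  ("\<ominus>_" [81] 80) where
  "\<ominus>a \<equiv> the_inverse (\<oplus>) a"

abbreviation circ_inv :: "'a \<Rightarrow> 'a"  ("_\<^sup>-" [1000] 999) where
  "a\<^sup>- \<equiv> the_inverse (\<odot>) a"

text \<open>
  In the Clifford semigroup \<open>(S, +)\<close>, a semilattice of groups, this is the zero of the group that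
  contains \<open>a\<close>. The multiplicative expression is equal to \<open>-a + a\<close> by the second brace axiom.
\<close>

definition local_zero :: "'a \<Rightarrow> 'a"  ("\<zero>\<^bsub>_\<^esub>") where
  "\<zero>\<^bsub>a\<^esub> = a \<odot> a\<^sup>-"

lemma local_zero_add: "\<zero>\<^bsub>a\<^esub> = \<ominus>a \<oplus> a"
  by (simp add: local_zero_def circ_inverse)

lemma idem_iff: "e \<oplus> e = e \<longleftrightarrow> e \<odot> e = e"
proof
  assume e: "e \<oplus> e = e"
  hence "e \<odot> e\<^sup>- = e"
    by (simp add: circ_inverse A.inverse_idem)
  thus "e \<odot> e = e"
    using C.idem_left[of e] by simp
next
  assume e: "e \<odot> e = e"
  hence "\<ominus>e \<oplus> e = e"
    using circ_inverse[of e] by (simp add: C.inverse_idem)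
  thus "e \<oplus> e = e"
    using A.idem_right[of e] by simp
qed

lemma local_zero_idem: "\<zero>\<^bsub>a\<^esub> \<oplus> \<zero>\<^bsub>a\<^esub> = \<zero>\<^bsub>a\<^esub>" "\<zero>\<^bsub>a\<^esub> \<odot> \<zero>\<^bsub>a\<^esub> = \<zero>\<^bsub>a\<^esub>"
  by (simp add: local_zero_add A.idem_right) (simp add: local_zero_def C.idem_left)

lemma local_zero_of_idem: "e \<oplus> e = e \<Longrightarrow> \<zero>\<^bsub>e\<^esub> = e"
  by (simp add: local_zero_add A.inverse_idem)

text \<open>
  Expanding \<open>a = a \<circ> (a\<^sup>- \<circ> a)\<close> by the brace axioms writes \<open>a\<close> as a sum that ends with \<open>-a + (-a + a)\<close>.
  Such a sum has \<open>a - a\<close> as a right unit, as this idempotent commutes with \<open>-a + a\<close> and is absorbed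
  by \<open>-a\<close>.
\<close>

lemma add_minus_cancel: "a \<oplus> (a \<oplus> \<ominus>a) = a"
proof -
  define b where "b = a \<odot> (\<ominus>(a\<^sup>-))"
  have "a = a \<odot> (a\<^sup>- \<odot> (a\<^sup>-)\<^sup>-)"
    by (simp add: C.inverse_inverse C.regular_assoc)
  also have "\<dots> = b \<oplus> \<ominus>a \<oplus> (\<ominus>a \<oplus> a)"
    by (simp add: circ_inverse circ_add b_def)
  finally have a: "a = b \<oplus> (\<ominus>a \<oplus> (\<ominus>a \<oplus> a))"
    by (simp add: A.assoc)
  have "\<ominus>a \<oplus> ((\<ominus>a \<oplus> a) \<oplus> (a \<oplus> \<ominus>a)) = \<ominus>a \<oplus> ((a \<oplus> \<ominus>a) \<oplus> (\<ominus>a \<oplus> a))"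
    by (simp only: A.idem_commute[OF A.idem_left[of a] A.idem_right[of a]])
  also have "\<dots> = \<ominus>a \<oplus> (\<ominus>a \<oplus> a)"
    by (simp add: A.assoc A.regular_assoc)
  finally have "\<ominus>a \<oplus> ((\<ominus>a \<oplus> a) \<oplus> (a \<oplus> \<ominus>a)) = \<ominus>a \<oplus> (\<ominus>a \<oplus> a)" .
  hence "(b \<oplus> (\<ominus>a \<oplus> (\<ominus>a \<oplus> a))) \<oplus> (a \<oplus> \<ominus>a) = b \<oplus> (\<ominus>a \<oplus> (\<ominus>a \<oplus> a))"
    by (simp only: A.assoc)
  thus ?thesis
    by (simp only: a[symmetric])
qed

text \<open>
  By \<open>add_minus_cancel\<close> the idempotent \<open>-a + a\<close> lies below \<open>a - a\<close> in the natural order; exchanging the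
  roles of \<open>a\<close> and \<open>-a\<close> gives the converse.
\<close>

lemma minus_add_commute: "a \<oplus> \<ominus>a = \<ominus>a \<oplus> a"
proof -
  have *: "(\<ominus>x \<oplus> x) \<oplus> (x \<oplus> \<ominus>x) = \<ominus>x \<oplus> x" for x
    by (simp add: A.assoc add_minus_cancel)
  show ?thesis
    using *[of a] *[of "\<ominus>a", unfolded A.inverse_inverse]
      A.idem_commute[OF A.idem_left[of a] A.idem_right[of a]]
    by (elim trans[OF trans[OF sym]])
qed

lemma local_zero_add': "\<zero>\<^bsub>a\<^esub> = a \<oplus> \<ominus>a"
  by (simp add: local_zero_add minus_add_commute)

lemma local_zero_central: "\<zero>\<^bsub>a\<^esub> \<oplus> b = b \<oplus> \<zero>\<^bsub>a\<^esub>"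
  by (rule A.idem_central[OF minus_add_commute local_zero_idem(1)])

lemma local_zero_left_commute: "b \<oplus> (\<zero>\<^bsub>a\<^esub> \<oplus> c) = \<zero>\<^bsub>a\<^esub> \<oplus> (b \<oplus> c)"
  using local_zero_central[of a b] by (metis A.assoc)

lemma local_zero_absorb: "\<zero>\<^bsub>a\<^esub> \<oplus> a = a" "\<zero>\<^bsub>a\<^esub> \<odot> a = a"
  by (simp add: local_zero_add' A.regular) (simp add: local_zero_def C.regular)

lemma local_zero_minus: "\<zero>\<^bsub>\<ominus>a\<^esub> = \<zero>\<^bsub>a\<^esub>"
  by (simp add: local_zero_add A.inverse_inverse minus_add_commute)

lemma local_zero_plus: "\<zero>\<^bsub>a \<oplus> b\<^esub> = \<zero>\<^bsub>a\<^esub> \<oplus> \<zero>\<^bsub>b\<^esub>"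
proof -
  have "\<zero>\<^bsub>a \<oplus> b\<^esub> = \<ominus>b \<oplus> (\<zero>\<^bsub>a\<^esub> \<oplus> b)"
    by (simp add: local_zero_add A.inverse_mult A.assoc)
  also have "\<dots> = \<zero>\<^bsub>a\<^esub> \<oplus> (\<ominus>b \<oplus> b)"
    by (rule local_zero_left_commute)
  finally show ?thesis
    by (simp add: local_zero_add)
qed

lemma idem_add_commute: "e \<oplus> e = e \<Longrightarrow> e \<oplus> a = a \<oplus> e"
  using local_zero_central[of e a] local_zero_of_idem by simp

text \<open>
  The two semilattice structures on the common set of idempotents agree. The idea is to compare their
  orders: \<open>e \<circ> f\<close> is an additive lower bound of \<open>e\<close> and \<open>f\<close>, and conversely an additive inequality
  \<open>g \<le> x\<close> implies \<open>g \<circ> x = g\<close>, which is applied to \<open>g = e + f\<close>.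
\<close>

lemma idem_circ_eq_add:
  assumes e: "e \<oplus> e = e" and f: "f \<oplus> f = f"
  shows "e \<odot> f = e \<oplus> f"
proof -
  have e': "e \<odot> e = e" and f': "f \<odot> f = f"
    using e f idem_iff by auto
  have neg: "\<ominus>x = x" if "x \<oplus> x = x" for x
    using that by (rule A.inverse_idem)
  have below: "x \<oplus> x \<odot> y = x \<odot> y" if x: "x \<oplus> x = x" and y: "y \<oplus> y = y" for x y
  proof -
    have "x \<odot> y \<oplus> x \<odot> y = x \<odot> y"
      by (rule idem_iff[THEN iffD2, OF C.idem_mult]) (use x y idem_iff in auto)
    moreover have "x \<odot> y = x \<odot> y \<oplus> x \<oplus> x \<odot> y"
      using circ_add[of x y y] by (simp add: x y neg)
    moreover have "x \<odot> y \<oplus> x = x \<oplus> x \<odot> y"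
      by (rule idem_add_commute[OF x, symmetric])
    ultimately show ?thesis
      by (simp add: A.assoc)
  qed
  \<comment> \<open>Expand \<open>g \<circ> (g + x)\<close>, which equals \<open>g \<circ> g\<close>, by the brace axiom.\<close>
  have sub: "g \<odot> x = g" if g: "g \<oplus> g = g" and x: "x \<oplus> x = x" and le: "g \<oplus> x = g" for g x
  proof -
    have "g = g \<odot> (g \<oplus> x)"
      using g le idem_iff by simp
    also have "\<dots> = g \<oplus> g \<odot> x"
      using circ_add[of g g x] by (simp add: g neg idem_iff[THEN iffD1, OF g])
    finally show ?thesis
      using below[OF g x] by simp
  qed
  define g where "g = e \<oplus> f"
  have g: "g \<oplus> g = g"
    unfolding g_def by (rule A.idem_mult[OF e f])
  have "g \<oplus> f = g"
    by (simp add: g_def A.assoc f)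
  moreover have "g \<oplus> e = g"
    using idem_add_commute[OF e, of f] by (simp add: g_def A.assoc e)
  ultimately have gef: "g \<odot> (e \<odot> f) = g"
    using sub[OF g e] sub[OF g f] by (simp flip: C.assoc)
  have ef: "e \<odot> f \<oplus> e \<odot> f = e \<odot> f"
    using C.idem_mult[OF e' f'] idem_iff by simp
  have "e \<odot> f \<odot> g = g"
    using C.idem_commute[OF C.idem_mult[OF e' f'] idem_iff[THEN iffD1, OF g]] gef by simp
  hence "g \<oplus> e \<odot> f = g"
    using below[OF ef g] idem_add_commute[OF g, of "e \<odot> f"] by simp
  moreover have "g \<oplus> e \<odot> f = e \<odot> f"
    using below[OF e f] below[OF f e] C.idem_commute[OF e' f'] by (simp add: g_def A.assoc)
  ultimately show ?thesis
    by (simp add: g_def)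
qed

text \<open>
  If the local zero of \<open>c\<close> lies below \<open>e\<close>, then \<open>e\<close> fixes \<open>c\<close> under \<open>\<circ>\<close>; this holds for \<open>c = e + a\<close>.
  On the other hand, \<open>e \<circ> (e + a) = e + e \<circ> a = e \<circ> a\<close>, as the local zero of \<open>e \<circ> a\<close> also lies below \<open>e\<close>.
\<close>

lemma idem_circ:
  assumes e: "e \<oplus> e = e"
  shows "e \<odot> a = e \<oplus> a"
proof -
  have e': "e \<odot> e = e" using e idem_iff by simp
  have fix_above: "e \<odot> c = c" if "e \<oplus> \<zero>\<^bsub>c\<^esub> = \<zero>\<^bsub>c\<^esub>" for c
  proof -
    have "e \<odot> c = e \<odot> \<zero>\<^bsub>c\<^esub> \<odot> c"
      by (simp add: C.assoc local_zero_absorb)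
    thus ?thesis
      using that by (simp add: idem_circ_eq_add[OF e local_zero_idem(1)] local_zero_absorb)
  qed
  have zc: "\<zero>\<^bsub>e \<odot> a\<^esub> = e \<odot> \<zero>\<^bsub>a\<^esub>"
  proof -
    have "\<zero>\<^bsub>e \<odot> a\<^esub> = e \<odot> (\<zero>\<^bsub>a\<^esub> \<odot> e)"
      by (simp add: local_zero_def C.inverse_mult C.inverse_idem[OF e'] C.assoc)
    also have "\<dots> = e \<odot> \<zero>\<^bsub>a\<^esub>"
      by (simp add: e' flip: C.assoc C.idem_commute[OF e' local_zero_idem(2)])
    finally show ?thesis .
  qed
  have "e \<oplus> \<zero>\<^bsub>e \<odot> a\<^esub> = \<zero>\<^bsub>e \<odot> a\<^esub>"
    by (simp add: zc idem_circ_eq_add[OF e local_zero_idem(1)] e flip: A.assoc)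
  hence "e \<oplus> (\<zero>\<^bsub>e \<odot> a\<^esub> \<oplus> e \<odot> a) = \<zero>\<^bsub>e \<odot> a\<^esub> \<oplus> e \<odot> a"
    by (simp flip: A.assoc)
  hence "e \<oplus> e \<odot> a = e \<odot> a"
    by (simp add: local_zero_absorb)
  hence "e \<odot> (e \<oplus> a) = e \<odot> a"
    by (simp add: circ_add e e' A.inverse_idem)
  moreover have "e \<odot> (e \<oplus> a) = e \<oplus> a"
    by (rule fix_above) (simp add: local_zero_plus local_zero_of_idem e flip: A.assoc)
  ultimately show ?thesis by simp
qed

lemma local_zero_circ: "\<zero>\<^bsub>a\<^esub> \<odot> b = \<zero>\<^bsub>a\<^esub> \<oplus> b"
  by (rule idem_circ[OF local_zero_idem(1)])

lemma local_zero_left_factor: "\<zero>\<^bsub>a\<^esub> \<oplus> a \<odot> b = a \<odot> b"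
  using local_zero_circ[of a "a \<odot> b"] local_zero_absorb(2)[of a] by (simp flip: C.assoc)

section \<open>Normal forms of the solution and of its opposite\<close>

text \<open>
  The first component is the brace axiom applied to \<open>a \<circ> (a\<^sup>- + b)\<close>. The second one holds since the
  element \<open>c = a\<^sup>- + b\<close> is unchanged by the idempotent \<open>a\<^sup>- \<circ> a\<close>, which is the local zero of \<open>a\<^sup>-\<close>.
\<close>

lemma brace_map_eq:
  "brace_map (\<oplus>) (\<odot>) (a, b) = (\<ominus>a \<oplus> a \<odot> b, (\<ominus>a \<oplus> a \<odot> b)\<^sup>- \<odot> (a \<odot> b))"
proof -
  let ?c = "a\<^sup>- \<oplus> b"
  have u: "a \<odot> ?c = \<ominus>a \<oplus> a \<odot> b"
    by (simp add: circ_add circ_inverse A.regular)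
  have "\<zero>\<^bsub>a\<^sup>-\<^esub> \<odot> ?c = ?c"
    using local_zero_absorb(1)[of "a\<^sup>-"] by (simp add: local_zero_circ flip: A.assoc)
  hence "?c\<^sup>- = ?c\<^sup>- \<odot> \<zero>\<^bsub>a\<^sup>-\<^esub>"
    using C.inverse_mult[of "\<zero>\<^bsub>a\<^sup>-\<^esub>" ?c] C.inverse_idem[OF local_zero_idem(2)] by simp
  moreover have "(a \<odot> ?c)\<^sup>- \<odot> (a \<odot> b) = ?c\<^sup>- \<odot> \<zero>\<^bsub>a\<^sup>-\<^esub> \<odot> b"
    by (simp add: local_zero_def C.inverse_inverse C.inverse_mult C.assoc)
  ultimately have "?c\<^sup>- \<odot> b = (a \<odot> ?c)\<^sup>- \<odot> (a \<odot> b)"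
    by simp
  thus ?thesis
    by (simp add: brace_map_def u)
qed

text \<open>
  The local zero of \<open>-a + a \<circ> b\<close> is the sum of those of \<open>a\<close> and \<open>a \<circ> b\<close>, and \<open>a \<circ> b\<close> absorbs both.
\<close>

lemma brace_map_product: "(\<ominus>a \<oplus> a \<odot> b) \<odot> ((\<ominus>a \<oplus> a \<odot> b)\<^sup>- \<odot> (a \<odot> b)) = a \<odot> b"
proof -
  let ?p = "a \<odot> b"
  have "\<zero>\<^bsub>\<ominus>a \<oplus> ?p\<^esub> \<odot> ?p = \<zero>\<^bsub>a\<^esub> \<oplus> (\<zero>\<^bsub>?p\<^esub> \<oplus> ?p)"
    by (simp only: local_zero_circ) (simp add: local_zero_plus local_zero_minus A.assoc)
  also have "\<dots> = ?p"
    by (simp add: local_zero_absorb local_zero_left_factor)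
  finally show ?thesis
    by (simp add: local_zero_def C.assoc)
qed

text \<open>
  The axiom \<open>a \<circ> a\<^sup>- = -a + a\<close> becomes \<open>a \<circ> a\<^sup>- = a - a\<close>, so this rests on the Clifford property.
\<close>

lemma weak_brace_opposite: "weak_brace (opposite (\<oplus>)) (\<odot>)"
proof -
  note inv = the_inverse_opposite[OF add_inverse_semigroup]
  have "inverse_semigroup (opposite (\<oplus>))"
  proof
    show "opposite (\<oplus>) (opposite (\<oplus>) a b) c = opposite (\<oplus>) a (opposite (\<oplus>) b c)" for a b c
      by (simp add: opposite_def A.assoc)
    show "\<exists>!x. inverse_of (opposite (\<oplus>)) a x" for a
      using A.ex1_inverse[of a] by (simp add: inverse_of_def opposite_def A.assoc)
  qed
  thus ?thesis
    by (intro weak_brace.intro)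
      (simp_all add: inv circ_inverse_semigroup circ_add circ_inverse A.assoc
        minus_add_commute opposite_def)
qed


lemma brace_map_opposite_eq:
  "brace_map (opposite (\<oplus>)) (\<odot>) (a, b) = (a \<odot> b \<oplus> \<ominus>a, (a \<odot> b \<oplus> \<ominus>a)\<^sup>- \<odot> (a \<odot> b))"
  using weak_brace.brace_map_eq[OF weak_brace_opposite]
  by (simp add: the_inverse_opposite[OF add_inverse_semigroup]) (simp add: opposite_def)

lemma brace_map_opposite_product:
  "(a \<odot> b \<oplus> \<ominus>a) \<odot> ((a \<odot> b \<oplus> \<ominus>a)\<^sup>- \<odot> (a \<odot> b)) = a \<odot> b"
  using weak_brace.brace_map_product[OF weak_brace_opposite]
  by (simp add: the_inverse_opposite[OF add_inverse_semigroup]) (simp add: opposite_def)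

text \<open>
  With the product \<open>p = a \<circ> b\<close> preserved, the first component is \<open>-(p - a) + p = a - p + p\<close>. In the
  opposite order of composition it is \<open>p - (-a + p) = p - p + a\<close>, which is the same by centrality.
\<close>

lemma brace_map_compose_opposite:
  "brace_map (\<oplus>) (\<odot>) (brace_map (opposite (\<oplus>)) (\<odot>) (a, b))
    = (\<zero>\<^bsub>a \<odot> b\<^esub> \<oplus> a, (\<zero>\<^bsub>a \<odot> b\<^esub> \<oplus> a)\<^sup>- \<odot> (a \<odot> b))"
proof -
  let ?p = "a \<odot> b"
  have "\<ominus>(?p \<oplus> \<ominus>a) \<oplus> ?p = a \<oplus> \<zero>\<^bsub>?p\<^esub>"
    by (simp add: A.inverse_mult A.inverse_inverse A.assoc local_zero_add)
  also have "\<dots> = \<zero>\<^bsub>?p\<^esub> \<oplus> a"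
    by (rule local_zero_central[symmetric])
  finally show ?thesis
    by (simp add: brace_map_opposite_eq brace_map_eq brace_map_opposite_product)
qed

lemma brace_map_opposite_compose:
  "brace_map (opposite (\<oplus>)) (\<odot>) (brace_map (\<oplus>) (\<odot>) (a, b))
    = (\<zero>\<^bsub>a \<odot> b\<^esub> \<oplus> a, (\<zero>\<^bsub>a \<odot> b\<^esub> \<oplus> a)\<^sup>- \<odot> (a \<odot> b))"
proof -
  let ?p = "a \<odot> b"
  have "?p \<oplus> \<ominus>(\<ominus>a \<oplus> ?p) = \<zero>\<^bsub>?p\<^esub> \<oplus> a"
    by (simp add: A.inverse_mult A.inverse_inverse local_zero_add' flip: A.assoc)
  thus ?thesis
    by (simp add: brace_map_opposite_eq brace_map_eq brace_map_product)
qed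

lemma brace_map_regular:
  "brace_map (\<oplus>) (\<odot>) (brace_map (opposite (\<oplus>)) (\<odot>) (brace_map (\<oplus>) (\<odot>) (a, b)))
    = brace_map (\<oplus>) (\<odot>) (a, b)"
proof -
  let ?p = "a \<odot> b"
  have "\<zero>\<^bsub>?p\<^esub> \<oplus> (\<ominus>a \<oplus> ?p) = \<ominus>a \<oplus> ?p"
    using local_zero_left_commute[of "\<ominus>a" ?p ?p] by (simp add: local_zero_absorb)
  thus ?thesis
    by (simp add: brace_map_eq[of a b] brace_map_compose_opposite brace_map_product)
qed

text \<open>
  Elimination of the additive structure: \<open>0\<^sub>p + a = p \<circ> p\<^sup>- \<circ> a\<close> for \<open>p = a \<circ> b\<close>, and moving the
  idempotent \<open>b \<circ> b\<^sup>-\<close> past \<open>a\<^sup>- \<circ> a\<close> leaves \<open>a \<circ> b \<circ> b\<^sup>-\<close>.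
\<close>

lemma brace_map_compose_opposite_eq:
  "brace_map (\<oplus>) (\<odot>) \<circ> brace_map (opposite (\<oplus>)) (\<odot>)
    = (\<lambda>(a, b). (a \<odot> (b \<odot> b\<^sup>-), a\<^sup>- \<odot> a \<odot> b))"
proof (rule ext, clarify)
  fix a b
  let ?p = "a \<odot> b"
  have "\<zero>\<^bsub>?p\<^esub> \<oplus> a = a \<odot> ((b \<odot> b\<^sup>-) \<odot> (a\<^sup>- \<odot> a))"
    by (simp only: local_zero_circ[symmetric]) (simp add: local_zero_def C.inverse_mult C.assoc)
  also have "\<dots> = a \<odot> ((a\<^sup>- \<odot> a) \<odot> (b \<odot> b\<^sup>-))"
    by (simp only: C.idem_commute[OF C.idem_left C.idem_right])
  also have "\<dots> = a \<odot> (b \<odot> b\<^sup>-)"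
    by (simp add: C.assoc C.regular_assoc)
  finally have fst: "\<zero>\<^bsub>?p\<^esub> \<oplus> a = a \<odot> (b \<odot> b\<^sup>-)" .
  have "(\<zero>\<^bsub>?p\<^esub> \<oplus> a)\<^sup>- \<odot> ?p = a\<^sup>- \<odot> (\<zero>\<^bsub>?p\<^esub> \<odot> ?p)"
    by (simp only: local_zero_circ[symmetric])
      (simp add: C.inverse_mult C.inverse_idem[OF local_zero_idem(2)] C.assoc)
  hence "(\<zero>\<^bsub>?p\<^esub> \<oplus> a)\<^sup>- \<odot> ?p = a\<^sup>- \<odot> a \<odot> b"
    by (simp add: local_zero_absorb C.assoc)
  with fst show "(brace_map (\<oplus>) (\<odot>) \<circ> brace_map (opposite (\<oplus>)) (\<odot>)) (a, b)
      = (a \<odot> (b \<odot> b\<^sup>-), a\<^sup>- \<odot> a \<odot> b)"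
    by (simp add: brace_map_compose_opposite)
qed

end

section \<open>Complete regularity of the solution\<close>

theorem theorem16:
  fixes add circ :: "'a \<Rightarrow> 'a \<Rightarrow> 'a"
    and r r_op :: "'a \<times> 'a \<Rightarrow> 'a \<times> 'a"
  assumes "weak_brace add circ"
    and "r = brace_map add circ"
    and "r_op = brace_map (opposite add) circ"
  shows "r \<circ> r_op \<circ> r = r \<and> r_op \<circ> r \<circ> r_op = r_op \<and> r \<circ> r_op = r_op \<circ> r
    \<and> completely_regular (\<circ>) r
    \<and> yang_baxter (r \<circ> r_op)
    \<and> (skew_brace add circ \<longrightarrow> bij r \<and> inv r = r_op)"
proof -
  interpret weak_brace add circ by fact
  interpret op: weak_brace "opposite add" circ by (rule weak_brace_opposite)
  have 1: "r \<circ> r_op \<circ> r = r"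
    by (auto simp: fun_eq_iff assms(2,3) brace_map_regular)
  have 2: "r_op \<circ> r \<circ> r_op = r_op"
    using op.brace_map_regular by (auto simp: fun_eq_iff assms(2,3) opposite_opposite)
  have 3: "r \<circ> r_op = r_op \<circ> r"
    by (auto simp: fun_eq_iff assms(2,3) brace_map_compose_opposite brace_map_opposite_compose)
  have "completely_regular (\<circ>) r"
    unfolding completely_regular_def inverse_of_def using 1 2 3 by blast
  moreover have "yang_baxter (r \<circ> r_op)"
    by (simp only: assms(2,3) brace_map_compose_opposite_eq C.yang_baxter_idem_exchange)
  moreover have "bij r \<and> inv r = r_op" if skew: "skew_brace add circ"
  proof -
    obtain e inv' where "group circ e inv'"
      using skew unfolding skew_brace_def by blast
    then interpret G: group circ e inv' .
    have "r \<circ> r_op = id"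
      unfolding assms(2,3) brace_map_compose_opposite_eq
      by (auto simp: fun_eq_iff group_the_inverse[OF G.group_axioms])
    thus ?thesis
      using 3 by (metis o_bij inv_unique_comp)
  qed
  ultimately show ?thesis
    using 1 2 3 by blast
qed

end
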